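(* For all $j,k\in\mathbb Z$ and $0\le m\le r+1$, the conserved quantity $c_m(j)$ of the $A_r$ $T$-system equals the partition function for $m$ hard particles on $G_r$: $$c_m(j)=\sum_{S}\ \prod_{\ell=1}^m y_{i_\ell}\bigl(j-2(r+\ell-m)-1+h(i_\ell),\,k\bigr),$$ where the sum is over all hard particle configurations $S=\{i_1<i_2<\dots<i_m\}$ of cardinality $m$ on $G_r$, and the weights are $$y_1(s,k)=\frac{T_{1,s+k,k+1}}{T_{1,s+k+1,k}},\quad y_{2\alpha+1}(s,k)=\frac{T_{\alpha+1,s+k-1,k+1}T_{\alpha,s+k+1,k}}{T_{\alpha+1,s+k,k}T_{\alpha,s+k,k+1}},\quad y_{2\alpha}(s,k)=\frac{T_{\alpha+1,s+k,k+1}T_{\alpha-1,s+k+1,k}}{T_{\alpha,s+k,k}T_{\alpha,s+k+1,k+1}}\quad(1\le\alpha\le r).$$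
   Context: $T$-system: fix $r\ge1$, $I_r=\{1,\dots,r\}$. Let $\{T_{\alpha,j,0},T_{\alpha,j,1}:\alpha\in I_r,\ j\in\mathbb Z\}$ be independent commuting variables and let $T_{\alpha,j,k}$ ($0\le\alpha\le r+1$, $j,k\in\mathbb Z$) be the nonzero elements of the field of rational functions in them determined by $T_{\alpha,j,k+1}T_{\alpha,j,k-1}=T_{\alpha,j+1,k}T_{\alpha,j-1,k}+T_{\alpha+1,j,k}T_{\alpha-1,j,k}$ ($\alpha\in I_r$), $T_{0,j,k}=T_{r+1,j,k}=1$. Conserved quantities: $c_m(n)$ ($0\le m\le r+1$, $n\in\mathbb Z$) are the coefficients, normalized by $c_0(n)=1$, of the linear recursion $\sum_{b=0}^{r+1}(-1)^b c_{r+1-b}(j-k)\,T_{1,j-b,k+b}=0$ valid for all $j,k\in\mathbb Z$; equivalently $c_m(j)=\det\bigl(T_{1,j+n+a-b,\,n+a+b-2}\bigr)$, with rows $1\le a\le r+1$ and columns $1\le b\le r+2$, $b\ne r+2-m$, for any $n\in\mathbb Z$. Graph: $G_r$ has vertices $1,2,\dots,2r+1$ and edges $\{2i-1,2i\}$, $\{2i,2i+1\}$ for $1\le i\le r$, and $\{2i-2,2i\}$ for $2\le i\le r$. A hard particle configuration on $G_r$ is a set of vertices no two of which are joined by an edge. The height function is $h(1)=0$ and $h(i)=\lfloor (i+1)/2\rfloor$ for $i>1$. *)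

theory Defs
  imports
    "HOL-Library.Poly_Mapping"
    "HOL-Library.Product_Lexorder"
    "HOL-Computational_Algebra.Fraction_Field"
begin

text \<open>
  Rational functions over \<open>'k\<close> in independent variables indexed by triples \<open>(\<alpha>, j, \<epsilon>)\<close>: the fraction
  field of the polynomial ring, where monomials are finitely supported exponent functions. The
  lexicographic order on triples only serves to make the polynomial ring an instance of
  \<^class>\<open>idom\<close>. Triples with \<open>\<alpha> \<notin> {1..r}\<close> or \<open>\<epsilon> > 1\<close> are never used below.
\<close>

type_synonym 'k ratfun = "(((nat \<times> int \<times> nat) \<Rightarrow>\<^sub>0 nat) \<Rightarrow>\<^sub>0 'k) fract"

definition ratfun_var :: "nat \<Rightarrow> int \<Rightarrow> nat \<Rightarrow> 'k::field_char_0 ratfun" where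
  "ratfun_var \<alpha> j \<epsilon> = Fract (Poly_Mapping.single (Poly_Mapping.single (\<alpha>, j, \<epsilon>) 1) 1) 1"

definition is_T_system :: "nat \<Rightarrow> (nat \<Rightarrow> int \<Rightarrow> int \<Rightarrow> 'k::field_char_0 ratfun) \<Rightarrow> bool" where
  "is_T_system r T \<longleftrightarrow>
     (\<forall>\<alpha>\<in>{1..r}. \<forall>j. T \<alpha> j 0 = ratfun_var \<alpha> j 0 \<and> T \<alpha> j 1 = ratfun_var \<alpha> j 1) \<and>
     (\<forall>\<alpha>\<in>{0..r+1}. \<forall>j k. T \<alpha> j k \<noteq> 0) \<and>
     (\<forall>j k. T 0 j k = 1 \<and> T (r+1) j k = 1) \<and>
     (\<forall>\<alpha>\<in>{1..r}. \<forall>j k.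
        T \<alpha> j (k+1) * T \<alpha> j (k-1) =
        T \<alpha> (j+1) k * T \<alpha> (j-1) k + T (\<alpha>+1) j k * T (\<alpha>-1) j k)"

definition is_conserved_quantities ::
    "nat \<Rightarrow> (nat \<Rightarrow> int \<Rightarrow> int \<Rightarrow> 'a::field) \<Rightarrow> (nat \<Rightarrow> int \<Rightarrow> 'a) \<Rightarrow> bool" where
  "is_conserved_quantities r T c \<longleftrightarrow>
     (\<forall>n. c 0 n = 1) \<and>
     (\<forall>j k. (\<Sum>b=0..r+1. (-1)^b * c (r+1-b) (j-k) * T 1 (j - int b) (k + int b)) = 0)"

definition G_edges :: "nat \<Rightarrow> nat set set" where
  "G_edges r =
     {{2*i-1, 2*i} | i. 1 \<le> i \<and> i \<le> r} \<union>
     {{2*i, 2*i+1} | i. 1 \<le> i \<and> i \<le> r} \<union>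
     {{2*i-2, 2*i} | i. 2 \<le> i \<and> i \<le> r}"

definition hard_particle_configs :: "nat \<Rightarrow> nat \<Rightarrow> nat set set" where
  "hard_particle_configs r m =
     {S. S \<subseteq> {1..2*r+1} \<and> card S = m \<and> (\<forall>u\<in>S. \<forall>v\<in>S. {u, v} \<notin> G_edges r)}"

definition height :: "nat \<Rightarrow> nat" where
  "height i = (if i = 1 then 0 else (i + 1) div 2)"

text \<open>For both vertices \<open>i = 2\<alpha>\<close> and \<open>i = 2\<alpha> + 1\<close> one has \<open>\<alpha> = i div 2\<close>.\<close>

definition weight ::
    "(nat \<Rightarrow> int \<Rightarrow> int \<Rightarrow> 'a::field) \<Rightarrow> nat \<Rightarrow> int \<Rightarrow> int \<Rightarrow> 'a" where
  "weight T i s k =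
     (let \<alpha> = i div 2 in
      if i = 1 then
        T 1 (s+k) (k+1) / T 1 (s+k+1) k
      else if odd i then
        (T (\<alpha>+1) (s+k-1) (k+1) * T \<alpha> (s+k+1) k) / (T (\<alpha>+1) (s+k) k * T \<alpha> (s+k) (k+1))
      else
        (T (\<alpha>+1) (s+k) (k+1) * T (\<alpha>-1) (s+k+1) k) / (T \<alpha> (s+k) k * T \<alpha> (s+k+1) (k+1)))"

end

theory Submission
  imports Defs
begin

text \<open>
  Removing the largest vertices from hard particle configurations shows that the operator
  \<open>P\<^sub>n g (x) = \<Sum>\<^sub>m (-1)\<^sup>m Z\<^sub>n\<^sub>,\<^sub>m(x) g (x + 2m)\<close>, whose coefficients are the partition functions on the vertices
  \<open>1, ..., 2n - 1\<close>, satisfies a three-term recursion in \<open>n\<close>. By the T-system this recursion is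
  equivalent to a pair of two-term recursions relating neighbouring values of \<open>k\<close>, which give
  by induction that \<open>P\<^sub>n\<close> annihilates \<open>n\<close> consecutive light rays of \<open>T\<^sub>1\<close>. For \<open>n = r + 1\<close> these
  are \<open>r + 1\<close> linear equations that the conserved quantities satisfy as well. They determine
  the coefficients: the same operators for the reflected T-system \<open>T\<^sub>\<alpha>\<^sub>,\<^sub>j\<^sub>,\<^sub>-\<^sub>k\<close> annihilate
  all columns of the system before the last, where their value is a quotient of entries of \<open>T\<close>,
  hence nonzero.
\<close>

section \<open>Hard particles\<close>

text \<open>Edges are listed from their smaller endpoint: \<open>u\<close> to \<open>u + 1\<close>
  always, \<open>u\<close> to \<open>u + 2\<close> for even \<open>u\<close>. The bound
  \<open>N\<close> may have either parity, so that vertices can be stripped one at a time from the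
  top.\<close>

definition indep_sets :: "nat \<Rightarrow> nat \<Rightarrow> nat set set" where
  "indep_sets N m =
     {S. S \<subseteq> {1..N} \<and> card S = m \<and> (\<forall>u\<in>S. Suc u \<notin> S \<and> (even u \<longrightarrow> u + 2 \<notin> S))}"

lemma hard_particle_configs_eq: "hard_particle_configs r m = indep_sets (2*r+1) m"
proof -
  have "(\<forall>u\<in>S. \<forall>v\<in>S. {u, v} \<notin> G_edges r) \<longleftrightarrow> (\<forall>u\<in>S. Suc u \<notin> S \<and> (even u \<longrightarrow> u + 2 \<notin> S))"
    if S: "S \<subseteq> {1..2*r+1}" for S
  proof
    assume indep: "\<forall>u\<in>S. \<forall>v\<in>S. {u, v} \<notin> G_edges r"
    show "\<forall>u\<in>S. Suc u \<notin> S \<and> (even u \<longrightarrow> u + 2 \<notin> S)"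
    proof (intro ballI conjI impI notI)
      fix u assume u: "u \<in> S" and v: "Suc u \<in> S"
      have "1 \<le> u" "u \<le> 2*r" using u v S by auto
      have "{u, Suc u} \<in> G_edges r"
      proof (cases "even u")
        case True
        then obtain i where "u = 2*i" by blast
        then show ?thesis using \<open>1 \<le> u\<close> \<open>u \<le> 2*r\<close> unfolding G_edges_def
          by (intro UnI1 UnI2) (auto intro!: exI[of _ i])
      next
        case False
        then obtain i where "u = 2*i+1" by (elim oddE)
        then show ?thesis using \<open>u \<le> 2*r\<close> unfolding G_edges_def
          by (intro UnI1) (auto intro!: exI[of _ "i+1"])
      qed
      with indep u v show False by blast
    next
      fix u assume u: "u \<in> S" "even u" and v: "u + 2 \<in> S"
      then obtain i where "u = 2*i" by blast
      moreover have "1 \<le> u" "u + 2 \<le> 2*r+1" using u v S by auto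
      ultimately have "{u, u+2} \<in> G_edges r" unfolding G_edges_def
        by (intro UnI2) (auto intro!: exI[of _ "i+1"])
      with indep u v show False by blast
    qed
  next
    assume *: "\<forall>u\<in>S. Suc u \<notin> S \<and> (even u \<longrightarrow> u + 2 \<notin> S)"
    show "\<forall>u\<in>S. \<forall>v\<in>S. {u, v} \<notin> G_edges r"
    proof (intro ballI notI)
      fix u v assume uv: "u \<in> S" "v \<in> S" "{u, v} \<in> G_edges r"
      from uv(3) consider i where "{u, v} = {2*i-1, 2*i}" "1 \<le> i"
        | i where "{u, v} = {2*i, 2*i+1}" | i where "{u, v} = {2*i-2, 2*i}" "2 \<le> i"
        unfolding G_edges_def by (elim UnE CollectE exE conjE) blast+
      then have "v = Suc u \<or> u = Suc v \<or> (even u \<and> v = u + 2) \<or> (even v \<and> u = v + 2)"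
        by cases (auto simp: doubleton_eq_iff)
      with * uv show False by blast
    qed
  qed
  then show ?thesis unfolding hard_particle_configs_def indep_sets_def by blast
qed

lemma finite_indep_sets: "finite (indep_sets N m)"
  by (rule finite_subset[of _ "Pow {1..N}"]) (auto simp: indep_sets_def)

lemma finite_indep_set: "S \<in> indep_sets N m \<Longrightarrow> finite S"
  by (auto simp: indep_sets_def intro: finite_subset)

lemma indep_sets_0_right [simp]: "indep_sets N 0 = {{}}"
  by (auto simp: indep_sets_def dest: finite_subset)

lemma indep_sets_0_left [simp]: "indep_sets 0 (Suc m) = {}"
  by (auto simp: indep_sets_def)

text \<open>The vertices below \<open>Suc N\<close> adjacent to it are \<open>N\<close> and, if
  \<open>Suc N\<close> is even, \<open>N - 1\<close>; what remains is \<open>{1..M}\<close>.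
  Truncated subtraction gives the correct \<open>M = 0\<close> for \<open>N \<le> 1\<close>.\<close>

lemma indep_sets_split:
  assumes M: "M = (if even N then N - 1 else N - 2)"
  shows "indep_sets (Suc N) (Suc m) = indep_sets N (Suc m) \<union> insert (Suc N) ` indep_sets M m"
proof (intro equalityI subsetI)
  fix S assume S: "S \<in> indep_sets (Suc N) (Suc m)"
  show "S \<in> indep_sets N (Suc m) \<union> insert (Suc N) ` indep_sets M m"
  proof (cases "Suc N \<in> S")
    case False
    then have "S \<in> indep_sets N (Suc m)"
      using S by (auto simp: indep_sets_def subset_iff le_Suc_eq)
    then show ?thesis ..
  next
    case True
    define S' where "S' = S - {Suc N}"
    have sub: "S' \<subseteq> {1..N}"
      using S by (auto simp: indep_sets_def S'_def subset_iff le_Suc_eq)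
    have "N \<notin> S'" using S True by (auto simp: indep_sets_def S'_def)
    moreover have "N - 1 \<notin> S'" if "even (Suc N)"
    proof
      assume *: "N - 1 \<in> S'"
      then have "N - 1 \<ge> 1" using sub by auto
      then have "N - 1 + 2 = Suc N" by simp
      moreover have "even (N - 1)" using that by auto
      ultimately show False using S True * by (auto simp: indep_sets_def S'_def)
    qed
    ultimately have S': "N \<notin> S'" "odd N \<Longrightarrow> N - 1 \<notin> S'" by auto
    have "S' \<subseteq> {1..M}"
    proof
      fix s assume s: "s \<in> S'"
      then have "1 \<le> s" "s \<le> N" using sub by auto
      moreover have "s \<noteq> N" "odd N \<Longrightarrow> s \<noteq> N - 1" using s S' by auto
      ultimately show "s \<in> {1..M}" by (auto simp: M)
    qed
    then have "S' \<in> indep_sets M m"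
      using S True finite_indep_set[OF S] by (auto simp: indep_sets_def S'_def)
    moreover have "S = insert (Suc N) S'" using True by (auto simp: S'_def)
    ultimately show ?thesis by blast
  qed
next
  fix S assume "S \<in> indep_sets N (Suc m) \<union> insert (Suc N) ` indep_sets M m"
  then show "S \<in> indep_sets (Suc N) (Suc m)"
  proof
    assume "S \<in> indep_sets N (Suc m)"
    then show ?thesis by (auto simp: indep_sets_def)
  next
    assume "S \<in> insert (Suc N) ` indep_sets M m"
    then obtain S' where S: "S = insert (Suc N) S'" and S': "S' \<in> indep_sets M m" by blast
    have "{1..M} \<subseteq> {1..N}" "N \<notin> {1..M}" "odd N \<Longrightarrow> N - 1 \<notin> {1..M}"
      using M by (auto split: if_splits)
    moreover have "S' \<subseteq> {1..M}" using S' by (simp add: indep_sets_def)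
    ultimately have sub: "S' \<subseteq> {1..N}" and "N \<notin> S'" and "odd N \<Longrightarrow> N - 1 \<notin> S'"
      by blast+
    moreover have "Suc N \<notin> S'" "Suc (Suc N) \<notin> S'" "N + 3 \<notin> S'" using sub by auto
    moreover have "finite S'" using S' by (rule finite_indep_set)
    ultimately show ?thesis using S' sub unfolding S indep_sets_def
      by (auto simp: subset_iff)
  qed
qed

section \<open>Weighted configuration sums and their recursion\<close>

definition config_weight :: "(nat \<Rightarrow> int \<Rightarrow> 'a::comm_ring_1) \<Rightarrow> int \<Rightarrow> nat set \<Rightarrow> 'a" where
  "config_weight y x S =
     (\<Prod>l=1..card S. y (sorted_list_of_set S ! (l - 1)) (x + 2 * (int (card S) - int l)))"

lemma config_weight_empty [simp]: "config_weight y x {} = 1"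
  by (simp add: config_weight_def)

text \<open>A particle is evaluated at \<open>x\<close> plus twice the number of larger particles. A
  new largest particle therefore sits at \<open>x\<close> and moves all others up by 2.\<close>

lemma config_weight_insert:
  assumes "finite S" "\<And>u. u \<in> S \<Longrightarrow> u < i"
  shows "config_weight y x (insert i S) = y i x * config_weight y (x + 2) S"
proof -
  have "i \<notin> S" using assms by blast
  have "sorted (sorted_list_of_set S @ [i])" "distinct (sorted_list_of_set S @ [i])"
    "set (sorted_list_of_set S @ [i]) = insert i S"
    using assms \<open>i \<notin> S\<close> by (auto simp: sorted_append less_imp_le)
  then have sl: "sorted_list_of_set (insert i S) = sorted_list_of_set S @ [i]"
    by (metis sorted_list_of_set.idem_if_sorted_distinct)
  have "config_weight y x (insert i S) =
    (\<Prod>l=1..Suc (card S). y ((sorted_list_of_set S @ [i]) ! (l - 1)) (x + 2 * (1 + int (card S) - int l)))"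
    using assms \<open>i \<notin> S\<close> by (simp add: config_weight_def sl)
  also have "\<dots> = (\<Prod>l=1..card S. y ((sorted_list_of_set S @ [i]) ! (l - 1)) (x + 2 * (1 + int (card S) - int l)))
     * y i x"
    by (subst prod.cl_ivl_Suc) (simp add: nth_append)
  also have "(\<Prod>l=1..card S. y ((sorted_list_of_set S @ [i]) ! (l - 1)) (x + 2 * (1 + int (card S) - int l)))
     = config_weight y (x + 2) S"
    unfolding config_weight_def
    by (rule prod.cong) (auto simp: nth_append algebra_simps)
  finally show ?thesis by (simp add: mult.commute)
qed

definition hard_sum :: "(nat \<Rightarrow> int \<Rightarrow> 'a::comm_ring_1) \<Rightarrow> nat \<Rightarrow> nat \<Rightarrow> int \<Rightarrow> 'a" where
  "hard_sum y N m x = (\<Sum>S\<in>indep_sets N m. config_weight y x S)"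

lemma hard_sum_0_right [simp]: "hard_sum y N 0 x = 1"
  by (simp add: hard_sum_def)

lemma hard_sum_0_left [simp]: "hard_sum y 0 (Suc m) x = 0"
  by (simp add: hard_sum_def)

lemma hard_sum_split:
  assumes M: "M = (if even N then N - 1 else N - 2)"
  shows "hard_sum y (Suc N) (Suc m) x = hard_sum y N (Suc m) x + y (Suc N) x * hard_sum y M m (x + 2)"
proof -
  have "M \<le> N" using M by auto
  have new: "Suc N \<notin> S" if "S \<in> indep_sets M m" for S
    using that \<open>M \<le> N\<close> by (auto simp: indep_sets_def)
  have inj: "inj_on (insert (Suc N)) (indep_sets M m)"
    using new by (intro inj_onI) (metis insert_ident)
  have "hard_sum y (Suc N) (Suc m) x = hard_sum y N (Suc m) x +
      (\<Sum>S\<in>insert (Suc N) ` indep_sets M m. config_weight y x S)"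
    unfolding hard_sum_def indep_sets_split[OF assms]
    by (rule sum.union_disjoint) (auto simp: finite_indep_sets, auto simp: indep_sets_def)
  also have "(\<Sum>S\<in>insert (Suc N) ` indep_sets M m. config_weight y x S)
      = (\<Sum>S\<in>indep_sets M m. y (Suc N) x * config_weight y (x + 2) S)"
    unfolding sum.reindex[OF inj] comp_def
  proof (rule sum.cong[OF refl])
    fix S assume "S \<in> indep_sets M m"
    then show "config_weight y x (insert (Suc N) S) = y (Suc N) x * config_weight y (x + 2) S"
      using \<open>M \<le> N\<close> by (intro config_weight_insert) (auto simp: finite_indep_set, auto simp: indep_sets_def)
  qed
  finally show ?thesis by (simp add: hard_sum_def sum_distrib_left)
qed

lemma hard_sum_odd:
  "hard_sum y (2*n+1) (Suc m) x =
     hard_sum y (2*n) (Suc m) x + y (2*n+1) x * hard_sum y (2*n-1) m (x + 2)"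
  using hard_sum_split[of "2*n-1" "2*n" y m x] by simp

lemma hard_sum_even:
  "hard_sum y (2*n+2) (Suc m) x =
     hard_sum y (2*n+1) (Suc m) x + y (2*n+2) x * hard_sum y (2*n-1) m (x + 2)"
  using hard_sum_split[of "2*n-1" "2*n+1" y m x] by simp

text \<open>The truncated subtraction makes \<open>n = 0\<close> the empty graph.\<close>

definition hard_poly :: "(nat \<Rightarrow> int \<Rightarrow> 'a::comm_ring_1) \<Rightarrow> nat \<Rightarrow> nat \<Rightarrow> int \<Rightarrow> 'a" where
  "hard_poly y n m x = hard_sum y (2*n-1) m x"

text \<open>Vertices \<open>2*n+3\<close> and \<open>2*n+2\<close> are stripped in turn. Occupying
  the odd one leaves \<open>{1..2*n+1}\<close>, occupying the even one leaves
  \<open>{1..2*n-1}\<close>, so the recursion closes on graphs with an odd last vertex.\<close>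

lemma hard_poly_simps [simp]:
  "hard_poly y n 0 x = 1"
  "hard_poly y 0 (Suc m) x = 0"
  "hard_poly y (Suc 0) (Suc m) x = y 1 x * hard_poly y 0 m (x + 2)"
  "hard_poly y (Suc (Suc n)) (Suc m) x = hard_poly y (Suc n) (Suc m) x
     + y (2*n+3) x * hard_poly y (Suc n) m (x + 2) + y (2*n+2) x * hard_poly y n m (x + 2)"
proof -
  show "hard_poly y n 0 x = 1" "hard_poly y 0 (Suc m) x = 0" by (simp_all add: hard_poly_def)
  show "hard_poly y (Suc 0) (Suc m) x = y 1 x * hard_poly y 0 m (x + 2)"
    using hard_sum_odd[of y 0 m x] by (simp add: hard_poly_def)
  have "2 * Suc (Suc n) - 1 = 2 * (n+1) + 1" "2 * (n+1) = 2*n+2" "2 * Suc n - 1 = 2*n+1"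
    by auto
  then show "hard_poly y (Suc (Suc n)) (Suc m) x = hard_poly y (Suc n) (Suc m) x
     + y (2*n+3) x * hard_poly y (Suc n) m (x + 2) + y (2*n+2) x * hard_poly y n m (x + 2)"
    using hard_sum_odd[of y "n+1" m x] hard_sum_even[of y n m x]
    by (simp add: hard_poly_def numeral_3_eq_3)
qed

lemma hard_poly_eq_0: "n < m \<Longrightarrow> hard_poly y n m x = 0"
proof (induction n arbitrary: m x rule: induct_nat_012)
  case 0 then show ?case by (cases m) auto
next
  case 1
  then obtain m' where "m = Suc (Suc m')" by (auto simp: less_iff_Suc_add)
  then show ?case by simp
next
  case (ge2 n)
  then obtain m' where "m = Suc m'" by (cases m) auto
  with ge2 show ?case by simp
qed

section \<open>Shift operators with alternating partition functions as coefficients\<close>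

definition hard_op :: "(nat \<Rightarrow> int \<Rightarrow> 'a::comm_ring_1) \<Rightarrow> nat \<Rightarrow> (int \<Rightarrow> 'a) \<Rightarrow> int \<Rightarrow> 'a" where
  "hard_op y n g x = (\<Sum>m\<le>n. (-1)^m * hard_poly y n m x * g (x + 2 * int m))"

lemma hard_op_extend: "n \<le> N \<Longrightarrow>
    hard_op y n g x = (\<Sum>m\<le>N. (-1)^m * hard_poly y n m x * g (x + 2 * int m))"
  unfolding hard_op_def by (rule sum.mono_neutral_left) (auto simp: hard_poly_eq_0)

lemma hard_op_0 [simp]: "hard_op y 0 g x = g x"
  by (simp add: hard_op_def)

lemma hard_op_1: "hard_op y (Suc 0) g x = g x - y 1 x * g (x + 2)"
  by (simp add: hard_op_def)

lemma hard_op_Suc_Suc: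
  "hard_op y (Suc (Suc n)) g x = hard_op y (Suc n) g x
     - y (2*n+3) x * hard_op y (Suc n) g (x + 2) - y (2*n+2) x * hard_op y n g (x + 2)"
proof -
  have shift: "x + 2 + 2 * int m = x + 2 * int (Suc m)" for m by simp
  have "hard_op y (Suc (Suc n)) g x = g x
     + (\<Sum>m\<le>Suc n. (-1)^(Suc m) * hard_poly y (Suc (Suc n)) (Suc m) x * g (x + 2 * int (Suc m)))"
    unfolding hard_op_def by (subst sum.atMost_Suc_shift) simp
  moreover have "hard_op y (Suc n) g x = g x
     + (\<Sum>m\<le>Suc n. (-1)^(Suc m) * hard_poly y (Suc n) (Suc m) x * g (x + 2 * int (Suc m)))"
    by (subst hard_op_extend[of _ "Suc (Suc n)"], simp, subst sum.atMost_Suc_shift) simp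
  moreover have "hard_op y (Suc n) g (x + 2) =
      (\<Sum>m\<le>Suc n. (-1)^m * hard_poly y (Suc n) m (x+2) * g (x + 2 * int (Suc m)))"
    unfolding hard_op_def shift ..
  moreover have "hard_op y n g (x + 2) =
      (\<Sum>m\<le>Suc n. (-1)^m * hard_poly y n m (x+2) * g (x + 2 * int (Suc m)))"
    by (subst hard_op_extend[of _ "Suc n"]) (simp_all only: shift le_SucI order_refl)
  ultimately show ?thesis
    \<comment> \<open>With the term \<open>m = 0\<close>, which is \<open>g x\<close>, split off and
      the ranges padded by zeros, the coefficients of \<open>g (x + 2 * int (Suc m))\<close> agree
      by the recursion for \<open>hard_poly\<close>.\<close>
    by (simp only: sum_distrib_left sum_subtractf[symmetric] add_diff_eq[symmetric])
      (rule arg_cong2[of _ _ _ _ plus], simp, rule sum.cong, auto simp: algebra_simps)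
qed

section \<open>The linear problem of the T-system\<close>

definition particle_weight ::
    "(nat \<Rightarrow> int \<Rightarrow> int \<Rightarrow> 'a::field) \<Rightarrow> int \<Rightarrow> nat \<Rightarrow> int \<Rightarrow> 'a" where
  "particle_weight T k i x = weight T i (x - 1 + int (height i)) k"

lemma hirota_divide:
  fixes D :: "'a::field"
  assumes "H * D = G * E + Y * K" and "Y \<noteq> 0" "E \<noteq> 0" "H \<noteq> 0"
  shows "D / (Y * E) = G / (Y * H) + K / (E * H)"
proof -
  have "D / (Y * E) = (H * D) / (Y * E * H)" using assms(4) by simp
  also have "\<dots> = G / (Y * H) + K / (E * H)"
    unfolding assms(1) using assms(2-4) by (simp add: add_divide_distrib mult_ac)
  finally show ?thesis .
qed

text \<open>These axioms are invariant under \<open>k\<close> to \<open>- k\<close>, so the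
  reflected array is again an instance; the uniqueness argument relies on this.\<close>

locale T_system =
  fixes r :: nat and T :: "nat \<Rightarrow> int \<Rightarrow> int \<Rightarrow> 'a::field"
  assumes nonzero: "\<alpha> \<le> r + 1 \<Longrightarrow> T \<alpha> j k \<noteq> 0"
    and T_0: "T 0 j k = 1"
    and T_rel: "1 \<le> \<alpha> \<Longrightarrow> \<alpha> \<le> r \<Longrightarrow>
       T \<alpha> j (k+1) * T \<alpha> j (k-1) = T \<alpha> (j+1) k * T \<alpha> (j-1) k + T (\<alpha>+1) j k * T (\<alpha>-1) j k"
begin

text \<open>The weight of vertex \<open>2*n+1\<close>. The exceptional height 0 of vertex 1 and
  \<open>T_0\<close> make the formula valid for \<open>n = 0\<close> too.\<close>

definition A :: "nat \<Rightarrow> int \<Rightarrow> int \<Rightarrow> 'a" where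
  "A n k x = (T (n+1) (x + k + int n - 1) (k+1) * T n (x + k + int n + 1) k) / (T (n+1) (x + k + int n) k * T n (x + k + int n) (k+1))"

definition B :: "nat \<Rightarrow> int \<Rightarrow> int \<Rightarrow> 'a" where
  "B n k x = (T (n+1) (x + k + int n - 1) (k+1) * T (n-1) (x + k + int n) k) / (T n (x + k + int n - 1) k * T n (x + k + int n) (k+1))"

definition L :: "nat \<Rightarrow> int \<Rightarrow> int \<Rightarrow> 'a" where
  "L n k x = (T (n+1) (x + k + int n - 1) (k+1) * T n (x + k + int n) (k-1)) / (T (n+1) (x + k + int n) k * T n (x + k + int n - 1) k)"

abbreviation P :: "nat \<Rightarrow> int \<Rightarrow> (int \<Rightarrow> 'a) \<Rightarrow> int \<Rightarrow> 'a" where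
  "P n k g x \<equiv> hard_op (particle_weight T k) n g x"

lemma particle_weight_odd: "particle_weight T k (2*n+1) x = A n k x"
  by (cases n) (simp_all add: particle_weight_def weight_def height_def A_def Let_def T_0 algebra_simps)

lemma particle_weight_even: "particle_weight T k (2*n+2) x = B (Suc n) k x"
  by (simp add: particle_weight_def weight_def height_def B_def Let_def algebra_simps)

lemma P_1: "P (Suc 0) k g x = g x - A 0 k x * g (x + 2)"
  using particle_weight_odd[of k 0 x] by (simp add: hard_op_1)

lemma P_Suc_Suc:
  "P (Suc (Suc n)) k g x = P (Suc n) k g x - A (Suc n) k x * P (Suc n) k g (x + 2)
     - B (Suc n) k x * P n k g (x + 2)"
  using particle_weight_odd[of k "Suc n" x] particle_weight_even[of k n x]
  by (simp add: hard_op_Suc_Suc eval_nat_numeral)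

lemma L_0: "L 0 k x = A 0 k x"
  by (simp add: L_def A_def T_0)

text \<open>The T-system relation at \<open>(n, q, k)\<close>, divided by entries of
  \<open>T\<close> and multiplied by the numerator factor common to all three terms.\<close>

lemma L_eq_A_plus_B:
  assumes "1 \<le> n" "n \<le> r"
  shows "L n k x = A n k x + B n k x"
proof -
  define q where "q = x + k + int n"
  have "T n q (k-1) / (T (n+1) q k * T n (q-1) k)
      = T n (q+1) k / (T (n+1) q k * T n q (k+1)) + T (n-1) q k / (T n (q-1) k * T n q (k+1))"
    using T_rel[OF assms, of q k] assms by (intro hirota_divide) (auto simp: nonzero)
  then have "T (n+1) (q-1) (k+1) * (T n q (k-1) / (T (n+1) q k * T n (q-1) k))
      = T (n+1) (q-1) (k+1) * (T n (q+1) k / (T (n+1) q k * T n q (k+1)))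
        + T (n+1) (q-1) (k+1) * (T (n-1) q k / (T n (q-1) k * T n q (k+1)))"
    by (simp only: distrib_left)
  then show ?thesis by (simp add: L_def A_def B_def q_def)
qed

text \<open>The T-system relation again, now at \<open>(n+1, q, k+1)\<close>: a second splitting of
  \<open>L\<close>, relating levels \<open>k\<close> and \<open>k+1\<close>.\<close>

lemma L_minus_A:
  assumes "n < r"
  shows "L n (k+1) x - A n k x = B (Suc n) k x"
proof -
  define q where "q = x + k + int n"
  have "T (n+1) q (k+2) / (T n q (k+1) * T (n+1) (q+1) (k+1))
      = T (n+1) (q-1) (k+1) / (T n q (k+1) * T (n+1) q k)
        + T (n+2) q (k+1) / (T (n+1) (q+1) (k+1) * T (n+1) q k)"
    using T_rel[of "n+1" q "k+1"] assms
    by (intro hirota_divide) (auto simp: nonzero algebra_simps)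
  then have "T (n+1) q (k+2) / (T n q (k+1) * T (n+1) (q+1) (k+1)) * T n (q+1) k
      = T (n+1) (q-1) (k+1) / (T n q (k+1) * T (n+1) q k) * T n (q+1) k
        + T (n+2) q (k+1) / (T (n+1) (q+1) (k+1) * T (n+1) q k) * T n (q+1) k"
    by (simp only: distrib_right)
  moreover have "L n (k+1) x = T (n+1) q (k+2) / (T n q (k+1) * T (n+1) (q+1) (k+1)) * T n (q+1) k"
    "A n k x = T (n+1) (q-1) (k+1) / (T n q (k+1) * T (n+1) q k) * T n (q+1) k"
    "B (Suc n) k x = T (n+2) q (k+1) / (T (n+1) (q+1) (k+1) * T (n+1) q k) * T n (q+1) k"
    by (simp_all add: L_def A_def B_def q_def algebra_simps)
  ultimately show ?thesis by simp
qed

lemma A_B_exchange: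
  assumes "1 \<le> n" "n \<le> r"
  shows "A n (k+1) x * B n k (x+2) = B n (k+1) x * A (n-1) k (x+2)"
proof -
  define q where "q = x + k + int n"
  have nz: "T (n-1) a b \<noteq> 0" "T n a b \<noteq> 0" "T (n+1) a b \<noteq> 0" for a b
    using assms nonzero by auto
  have "x + (k+1) + int n = q + 1" "x + (k+1) + int n - 1 = q" "k + 1 + 1 = k + 2"
    "x + 2 + k + int n = q + 2" "q + 2 - 1 = q + 1" "q + 1 + 1 = q + 2"
    "x + 2 + k + int (n-1) = q + 1" "q + 1 - 1 = q" "n - 1 + 1 = n"
    using assms by (auto simp: q_def)
  note args = this
  have "A n (k+1) x = (T (n+1) q (k+2) * T n (q+2) (k+1)) / (T (n+1) (q+1) (k+1) * T n (q+1) (k+2))"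
    unfolding A_def args ..
  moreover have "B n k (x+2) = (T (n+1) (q+1) (k+1) * T (n-1) (q+2) k) / (T n (q+1) k * T n (q+2) (k+1))"
    unfolding B_def args ..
  moreover have "B n (k+1) x = (T (n+1) q (k+2) * T (n-1) (q+1) (k+1)) / (T n q (k+1) * T n (q+1) (k+2))"
    unfolding B_def args ..
  moreover have "A (n-1) k (x+2) = (T n q (k+1) * T (n-1) (q+2) k) / (T n (q+1) k * T (n-1) (q+1) (k+1))"
    unfolding A_def args ..
  ultimately show ?thesis using nz by simp
qed

text \<open>Up to normalization \<^term>\<open>P n k g x\<close> is a Casorati determinant of \<open>n\<close> light rays and \<open>g\<close>;
  the two recursions are its Desnanot-Jacobi identities with the first or the last ray removed.\<close>

lemma P_Suc:
  assumes "n \<le> r"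
  shows "P (Suc n) k g x = P n (k+1) g x - A n k x * P n k g (x+2)"
    and "P (Suc n) k g x = P n k g x - L n k x * P n (k-1) g (x+2)"
proof -
  \<comment> \<open>Both recursions are proved together for all \<open>k\<close> and
    \<open>x\<close>, since each induction step combines them at neighbouring levels.\<close>
  have "P (Suc n) k g x = P n (k+1) g x - A n k x * P n k g (x+2) \<and>
      P (Suc n) k g x = P n k g x - L n k x * P n (k-1) g (x+2)" for k x
    using assms
  proof (induction n arbitrary: k x)
    case 0
    then show ?case by (simp add: P_1 L_0)
  next
    case (Suc n)
    have a: "P (Suc n) k g x = P n (k+1) g x - A n k x * P n k g (x+2)"
      and b: "P (Suc n) (k+1) g x = P n (k+1) g x - L n (k+1) x * P n k g (x+2)" for k x
      using Suc.IH[of k x] Suc.IH[of "k+1" x] Suc.prems by auto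
    \<comment> \<open>The difference of \<open>b\<close> and \<open>a\<close>: both start from
      \<open>P n (k+1) g x\<close>, and \<open>L_minus_A\<close> evaluates the difference of the
      coefficients.\<close>
    have c: "P (Suc n) (k+1) g x = P (Suc n) k g x - B (Suc n) k x * P n k g (x+2)" for k x
      using Suc.prems unfolding a[of k] b by (simp add: L_minus_A[symmetric] algebra_simps)
    have "P (Suc (Suc n)) k g x = P (Suc n) k g x - A (Suc n) k x * P (Suc n) k g (x+2)
        - B (Suc n) k x * P n k g (x+2)"
      by (rule P_Suc_Suc)
    moreover have "A (Suc n) k x * P (Suc n) k g (x+2) + B (Suc n) k x * P n k g (x+2)
        = L (Suc n) k x * P (Suc n) (k-1) g (x+2)"
    proof -
      \<comment> \<open>In terms of \<open>p\<close> and \<open>s\<close>, the \<open>s\<close>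
        terms cancel by \<open>A_B_exchange\<close> and the coefficients of \<open>p\<close> add up
        to \<open>L\<close>.\<close>
      define p s where "p = P (Suc n) (k-1) g (x+2)" and "s = P n (k-1) g (x+2+2)"
      have "P (Suc n) k g (x+2) = p - B (Suc n) (k-1) (x+2) * s"
        using c[of "k-1" "x+2"] by (simp add: p_def s_def)
      moreover have "P n k g (x+2) = p + A n (k-1) (x+2) * s"
        using a[of "k-1" "x+2"] by (simp add: p_def s_def)
      moreover have "L (Suc n) k x = A (Suc n) k x + B (Suc n) k x"
        using Suc.prems by (intro L_eq_A_plus_B) auto
      moreover have "A (Suc n) k x * B (Suc n) (k-1) (x+2) = B (Suc n) k x * A n (k-1) (x+2)"
        using A_B_exchange[of "Suc n" "k-1" x] Suc.prems by simp
      then have "A (Suc n) k x * (B (Suc n) (k-1) (x+2) * s) = B (Suc n) k x * (A n (k-1) (x+2) * s)"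
        by (simp only: mult.assoc[symmetric])
      ultimately show ?thesis
        unfolding p_def[symmetric] by (simp only: right_diff_distrib distrib_left distrib_right) simp
    qed
    ultimately have "P (Suc (Suc n)) k g x
        = P (Suc n) k g x - L (Suc n) k x * P (Suc n) (k-1) g (x+2)"
      by (simp add: algebra_simps)
    moreover have "P (Suc (Suc n)) k g x
        = P (Suc n) (k+1) g x - A (Suc n) k x * P (Suc n) k g (x+2)"
      unfolding c P_Suc_Suc by simp
    ultimately show ?case by blast
  qed
  then show "P (Suc n) k g x = P n (k+1) g x - A n k x * P n k g (x+2)"
    and "P (Suc n) k g x = P n k g x - L n k x * P n (k-1) g (x+2)" by blast+
qed

section \<open>Action of the operators on light rays\<close>

text \<open>Light-cone coordinates \<open>u = j + k\<close> and \<open>v = j - k\<close>; only pairs of equal parity are meaningful.\<close>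

definition F :: "int \<Rightarrow> int \<Rightarrow> 'a" where
  "F u v = T 1 ((u + v) div 2) ((u - v) div 2)"

lemma F_eq: "F (x + 2*a) (x + 2*b) = T 1 (x + a + b) (a - b)"
proof -
  have "x + 2*a + (x + 2*b) = 2 * (x + a + b)" "x + 2*a - (x + 2*b) = 2 * (a - b)" by auto
  then show ?thesis by (simp only: F_def) simp
qed

text \<open>In the first recursion of \<open>P_Suc\<close>, ray \<open>i > 0\<close> becomes ray
  \<open>i - 1\<close> in both terms; in the second, ray 0 stays ray 0. This leaves one ray and
  \<open>n = 1\<close>, where \<open>A 0 k x\<close> is the ratio of two successive values on the
  ray.\<close>

lemma P_annihilates:
  assumes "i < n" "n \<le> r + 1"
  shows "P n k (\<lambda>y. F (x + 2*k + 2 * int i) (y - 2)) x = 0"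
  using assms
proof (induction n arbitrary: k x i)
  case (Suc n)
  show ?case
  proof (cases i)
    case (Suc i')
    then show ?thesis
      using P_Suc(1)[of n k "\<lambda>y. F (x + 2*k + 2 * int i) (y - 2)" x] Suc.IH[of i' "k+1" x] Suc.IH[of i' k "x+2"] Suc.prems
      by (simp add: algebra_simps)
  next
    case 0
    show ?thesis
    proof (cases "n = 0")
      case False
      then show ?thesis
        using P_Suc(2)[of n k "\<lambda>y. F (x + 2*k) (y - 2)" x] Suc.IH[of 0 k x] Suc.IH[of 0 "k-1" "x+2"] Suc.prems 0
        by (simp add: algebra_simps)
    next
      case True
      have "F (x + 2*k) (x - 2) = T 1 (x + k - 1) (k + 1)" "F (x + 2*k) x = T 1 (x + k) k"
        using F_eq[of x k "-1"] F_eq[of x k 0] by simp_all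
      moreover have "T 1 (x + k) k \<noteq> 0" by (simp add: nonzero)
      ultimately show ?thesis using 0 True by (simp add: P_1 A_def T_0)
    qed
  qed
qed simp

text \<open>Ray \<open>n\<close> is the first ray beyond those annihilated. The first recursion
  turns ray \<open>Suc n\<close> into ray \<open>n\<close> in both terms, and the T-system relation
  merges the two quotients into one.\<close>

lemma P_adjacent:
  assumes "n \<le> r"
  shows "P n k (\<lambda>y. F (x + 2*k + 2 * int n) (y - 2)) x
    = T (n+1) (x + k + int n - 1) (k+1) / T n (x + k + int n - 1) k"
  using assms
proof (induction n arbitrary: k x)
  case 0
  have "F (x + 2*k) (x - 2) = T 1 (x + k - 1) (k + 1)"
    using F_eq[of x k "-1"] by simp
  then show ?case by (simp add: T_0)
next
  case (Suc n)
  define q where "q = x + k + int n"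
  define g where "g = (\<lambda>y. F (x + 2*k + 2 * int (Suc n)) (y - 2))"
  have "P n (k+1) g x = T (n+1) q (k+2) / T n q (k+1)"
    using Suc.IH[of "k+1" x] Suc.prems by (simp add: g_def q_def algebra_simps)
  moreover have "P n k g (x+2) = T (n+1) (q+1) (k+1) / T n (q+1) k"
    using Suc.IH[of k "x+2"] Suc.prems by (simp add: g_def q_def algebra_simps)
  moreover have "P (Suc n) k g x = P n (k+1) g x - A n k x * P n k g (x+2)"
    using Suc.prems by (intro P_Suc) auto
  moreover have "A n k x = (T (n+1) (q-1) (k+1) * T n (q+1) k) / (T (n+1) q k * T n q (k+1))"
    by (simp add: A_def q_def)
  moreover have nz: "T n a b \<noteq> 0" "T (n+1) a b \<noteq> 0" for a b using Suc.prems nonzero by auto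
  have "T (n+1) q (k+2) / (T n q (k+1) * 1) =
      T (n+1) (q-1) (k+1) * T (n+1) (q+1) (k+1) / (T n q (k+1) * T (n+1) q k) + T (n+2) q (k+1) / (1 * T (n+1) q k)"
    using T_rel[of "n+1" q "k+1"] Suc.prems nz
    by (intro hirota_divide) (auto simp: algebra_simps)
  ultimately have "P (Suc n) k g x = T (n+2) q (k+1) / T (n+1) q k"
    using nz by (simp add: mult_ac)
  moreover have "x + k + int (Suc n) - 1 = q" by (simp add: q_def)
  ultimately show ?case by (simp add: g_def)
qed

text \<open>Gaussian elimination: combining equations \<open>0..m\<close> with the coefficients of
  \<open>P m k\<close> kills all columns before \<open>m\<close> and leaves a nonzero pivot in
  column \<open>m\<close>. Columns after \<open>m\<close> vanish by downward induction.\<close>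

lemma F_independent:
  assumes "\<And>i. i \<le> r \<Longrightarrow> (\<Sum>m\<le>r. e m * F (z + 2 * int m) (z - 2 - 2*k + 2 * int i)) = 0"
    and "m \<le> r"
  shows "e m = 0"
  using \<open>m \<le> r\<close>
proof (induction "r - m" arbitrary: m rule: less_induct)
  case less
  \<comment> \<open>Then \<open>x + 2*k = z\<close>, so column \<open>l\<close> is exactly ray
    \<open>l\<close> for \<open>P m k\<close>.\<close>
  define x where "x = z - 2*k"
  have "0 = P m k (\<lambda>y. \<Sum>l\<le>r. e l * F (z + 2 * int l) (y - 2)) x"
    unfolding hard_op_def
  proof (rule sum.neutral[symmetric], intro ballI)
    fix i assume "i \<in> {..m}"
    then have "(\<Sum>l\<le>r. e l * F (z + 2 * int l) (x + 2 * int i - 2)) = 0"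
      using assms(1)[of i] less.prems by (simp add: x_def algebra_simps)
    then show "(-1)^i * hard_poly (particle_weight T k) m i x *
        (\<Sum>l\<le>r. e l * F (z + 2 * int l) (x + 2 * int i - 2)) = 0" by simp
  qed
  also have "\<dots> = (\<Sum>l\<le>r. e l * P m k (\<lambda>y. F (z + 2 * int l) (y - 2)) x)"
    unfolding hard_op_def sum_distrib_left by (subst sum.swap) (simp add: mult_ac)
  also have "\<dots> = (\<Sum>l\<in>{m}. e l * P m k (\<lambda>y. F (z + 2 * int l) (y - 2)) x)"
  proof (rule sum.mono_neutral_right)
    show "\<forall>l\<in>{..r} - {m}. e l * P m k (\<lambda>y. F (z + 2 * int l) (y - 2)) x = 0"
    proof
      fix l assume l: "l \<in> {..r} - {m}"
      show "e l * P m k (\<lambda>y. F (z + 2 * int l) (y - 2)) x = 0"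
      proof (cases "l < m")
        case True
        then show ?thesis using P_annihilates[of l m k x] less.prems by (simp add: x_def)
      next
        case False
        then have "r - l < r - m" using l by auto
        then show ?thesis using less.hyps[of l] l by simp
      qed
    qed
  qed (use less.prems in auto)
  also have "\<dots> = e m * (T (m+1) (x + k + int m - 1) (k+1) / T m (x + k + int m - 1) k)"
    using P_adjacent[OF less.prems, of k x] by (simp add: x_def)
  finally show ?case using nonzero[of m] nonzero[of "m+1"] less.prems by simp
qed

end

section \<open>Reflection and identification of the conserved quantities\<close>

lemma T_system_reflect:
  assumes "T_system r T"
  shows "T_system r (\<lambda>\<alpha> j k. T \<alpha> j (- k))"
proof -
  interpret T_system r T by fact
  show ?thesis
  proof
    fix \<alpha> :: nat and j k :: int assume "1 \<le> \<alpha>" "\<alpha> \<le> r"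
    have e: "- (k+1) = - k - 1" "- (k-1) = - k + 1" by auto
    from T_rel[OF \<open>1 \<le> \<alpha>\<close> \<open>\<alpha> \<le> r\<close>, of j "-k"]
    show "T \<alpha> j (- (k+1)) * T \<alpha> j (- (k-1)) =
       T \<alpha> (j+1) (-k) * T \<alpha> (j-1) (-k) + T (\<alpha>+1) j (-k) * T (\<alpha>-1) j (-k)"
      unfolding e by (simp only: mult.commute)
  qed (auto simp: nonzero T_0)
qed

context T_system
begin

lemma conserved_eq_hard_poly:
  assumes c: "is_conserved_quantities r T c" and "m \<le> r + 1"
  shows "c m j = hard_poly (particle_weight T k) (r+1) m (j - 2 * int r)"
proof -
  interpret dual: T_system r "\<lambda>\<alpha> j k. T \<alpha> j (- k)"
    by (rule T_system_reflect) unfold_locales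
  define x where "x = j - 2 * int r"
  define p where "p m = hard_poly (particle_weight T k) (r+1) m x" for m
  \<comment> \<open>The index is shifted because both coefficients of index 0 equal 1; this leaves
    \<open>r + 1\<close> unknowns for \<open>r + 1\<close> equations.\<close>
  define e where "e m = (-1)^(Suc m) * (c (Suc m) j - p (Suc m))" for m
  have "e m = 0" if "m \<le> r" for m
  \<comment> \<open>Reflection exchanges the two light-cone coordinates, so columns of the system
    become rays of the dual. The level \<open>- 1 - k\<close> makes the second argument equal to
    \<open>x + 2*k + 2 * int i\<close>.\<close>
  proof (rule dual.F_independent[of e x "- 1 - k", OF _ that])
    fix i assume "i \<le> r"
    \<comment> \<open>This choice puts the entries of the conserved-quantity recursion on ray
      \<open>i\<close>; subtracting \<open>int (r+1)\<close> from both arguments keeps the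
      difference equal to \<open>j\<close>.\<close>
    define K where "K = k + int i + 1"
    have "(\<Sum>b=0..r+1. (-1)^b * c (r+1-b) (j + K - int (r+1) - (K - int (r+1)))
        * T 1 (j + K - int (r+1) - int b) (K - int (r+1) + int b)) = 0"
      using c unfolding is_conserved_quantities_def by blast
    then have "0 = (\<Sum>b\<le>r+1. (-1)^b * c (r+1-b) j
        * T 1 (j + K - int (r+1) - int b) (K - int (r+1) + int b))"
      by (simp add: atLeast0AtMost)
    also have "\<dots> = (\<Sum>m\<le>r+1. (-1)^(r+1-m) * c m j * T 1 (x + K + int m - 2) (K - int m))"
      by (rule sum.reindex_bij_witness[of _ "\<lambda>m. r+1-m" "\<lambda>m. r+1-m"])
        (auto simp: x_def of_nat_diff algebra_simps)
    also have "\<dots> = (\<Sum>m\<le>r+1. (-1)^(r+1) * ((-1)^m * c m j * T 1 (x + K + int m - 2) (K - int m)))"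
      by (rule sum.cong) (auto simp: uminus_power_if)
    finally have C: "(\<Sum>m\<le>r+1. (-1)^m * c m j * T 1 (x + K + int m - 2) (K - int m)) = 0"
      by (simp only: sum_distrib_left[symmetric]) simp
    have F: "F (x + 2*k + 2 * int i) (x + 2 * int m - 2) = T 1 (x + K + int m - 2) (K - int m)" for m
      using F_eq[of "x - 2" K "int m"] by (simp add: K_def algebra_simps)
    have "P (r+1) k (\<lambda>y. F (x + 2*k + 2 * int i) (y - 2)) x = 0"
      using \<open>i \<le> r\<close> by (intro P_annihilates) auto
    then have "(\<Sum>m\<le>r+1. (-1)^m * p m * T 1 (x + K + int m - 2) (K - int m)) = 0"
      unfolding hard_op_def F p_def .
    with C have "0 = (\<Sum>m\<le>r+1. (-1)^m * (c m j - p m) * T 1 (x + K + int m - 2) (K - int m))"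
      by (simp only: right_diff_distrib left_diff_distrib sum_subtractf) simp
    also have "\<dots> = (\<Sum>m\<le>r. e m * T 1 (x + K + int (Suc m) - 2) (K - int (Suc m)))"
      using c unfolding Suc_eq_plus1[symmetric]
      by (subst sum.atMost_Suc_shift) (simp add: e_def p_def is_conserved_quantities_def)
    also have "\<dots> = (\<Sum>m\<le>r. e m * dual.F (x + 2 * int m) (x - 2 - 2 * (- 1 - k) + 2 * int i))"
      using dual.F_eq[of x _ "k + int i"] by (intro sum.cong) (auto simp: K_def algebra_simps)
    finally show "(\<Sum>m\<le>r. e m * dual.F (x + 2 * int m) (x - 2 - 2 * (- 1 - k) + 2 * int i)) = 0"
      by simp
  qed
  moreover have "c 0 j = p 0" using c by (simp add: is_conserved_quantities_def p_def)
  ultimately have "c m j = p m" using \<open>m \<le> r + 1\<close> by (cases m) (auto simp: e_def)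
  then show ?thesis by (simp add: p_def x_def)
qed

end

theorem corollary4p7:
  fixes r :: nat
    and T :: "nat \<Rightarrow> int \<Rightarrow> int \<Rightarrow> 'k::field_char_0 ratfun"
    and c :: "nat \<Rightarrow> int \<Rightarrow> 'k ratfun"
    and j k :: int
    and m :: nat
  assumes "r \<ge> 1"
    and "is_T_system r T"
    and "is_conserved_quantities r T c"
    and "m \<le> r + 1"
  shows "c m j =
    (\<Sum>S\<in>hard_particle_configs r m.
       \<Prod>l=1..m.
         (let i = sorted_list_of_set S ! (l - 1)
          in weight T i (j - 2 * (int r + int l - int m) - 1 + int (height i)) k))"
proof -
  interpret T_system r T
    using assms(2) by unfold_locales (auto simp: is_T_system_def)
  \<comment> \<open>The base point comes from splitting \<open>j - 2*(r + l - m)\<close> as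
    \<open>(j - 2*r) + 2*(m - l)\<close>, where \<open>m - l\<close> counts the larger
    particles.\<close>
  have "c m j = hard_sum (particle_weight T k) (2*r+1) m (j - 2 * int r)"
    using conserved_eq_hard_poly[OF assms(3,4)] by (simp add: hard_poly_def)
  also have "\<dots> = (\<Sum>S\<in>hard_particle_configs r m.
       \<Prod>l=1..m.
         (let i = sorted_list_of_set S ! (l - 1)
          in weight T i (j - 2 * (int r + int l - int m) - 1 + int (height i)) k))"
    unfolding hard_sum_def hard_particle_configs_eq
    by (rule sum.cong)
      (auto simp: config_weight_def particle_weight_def indep_sets_def Let_def algebra_simps)
  finally show ?thesis .
qed

end
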